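(* Let $k\ge 2$ and let $C$ be a relaxed $k$-ary tree. Then $C$ is a compacted $k$-ary tree if and only if no two distinct internal nodes $u,v$ of $C$ have the same children in the same order. Moreover, if $C$ is not a compacted $k$-ary tree, then there exists a pair $(u,v)$ of distinct internal nodes with identical ordered children such that $v$ is a cherry and $u$ precedes $v$ in postorder.
   Context: An ordered DAG is a finite directed acyclic graph in which the outgoing edges of each node carry a left-to-right order (multiple edges allowed). A relaxed $k$-ary tree is an ordered DAG with a unique source and a unique sink in which every node other than the sink has out-degree exactly $k$. Internal nodes are all nodes except the sink. The spine is the spanning tree produced by depth-first search from the source (children visited left to right); its edges are internal edges, and all other edges are called pointers. Nodes are ordered in postorder along the spine. An internal node is a cherry if all its $k$ outgoing edges are pointers. For an internal node $u$, $T(u)$ denotes the ordered $k$-ary tree associated with $u$, obtained by unfolding the DAG below $u$ (the rooted ordered tree whose nodes correspond to directed paths starting at $u$, with the sink giving leaves). A compacted $k$-ary tree is a relaxed $k$-ary tree in which for any two distinct internal nodes $u,v$ the trees $T(u)$ and $T(v)$ are not identical. *)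

theory Defs
  imports Main
begin

text \<open>
  The outgoing edges of a node are given by the list of their heads, from left to right, so
  multiple edges are allowed. The edge leaving \<open>u\<close> at position \<open>i\<close> is denoted by \<open>(u, i)\<close>.
\<close>

record 'a ordered_digraph =
  nodes :: "'a set"
  children :: "'a \<Rightarrow> 'a list"

definition edges :: "'a ordered_digraph \<Rightarrow> ('a \<times> nat) set" where
  "edges G = {(u, i). u \<in> nodes G \<and> i < length (children G u)}"

definition adjacency :: "'a ordered_digraph \<Rightarrow> ('a \<times> 'a) set" where
  "adjacency G = {(u, v). u \<in> nodes G \<and> v \<in> set (children G u)}"

definition ordered_dag :: "'a ordered_digraph \<Rightarrow> bool" where
  "ordered_dag G \<longleftrightarrow>
     finite (nodes G) \<and> (\<forall>u \<in> nodes G. set (children G u) \<subseteq> nodes G) \<and> acyclic (adjacency G)"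

definition is_source :: "'a ordered_digraph \<Rightarrow> 'a \<Rightarrow> bool" where
  "is_source G s \<longleftrightarrow> s \<in> nodes G \<and> (\<forall>u \<in> nodes G. s \<notin> set (children G u))"

definition is_sink :: "'a ordered_digraph \<Rightarrow> 'a \<Rightarrow> bool" where
  "is_sink G t \<longleftrightarrow> t \<in> nodes G \<and> children G t = []"

definition internal_nodes :: "'a ordered_digraph \<Rightarrow> 'a set" where
  "internal_nodes G = {u \<in> nodes G. \<not> is_sink G u}"

definition relaxed_tree :: "nat \<Rightarrow> 'a ordered_digraph \<Rightarrow> bool" where
  "relaxed_tree k G \<longleftrightarrow>
     ordered_dag G \<and> (\<exists>!s. is_source G s) \<and> (\<exists>!t. is_sink G t) \<and>
     (\<forall>u \<in> internal_nodes G. length (children G u) = k)"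

text \<open>
  The functions below recurse along the edges of a graph. They are guarded by \<open>ordered_dag\<close>,
  which makes them total; only their values on nodes of ordered DAGs are meaningful.
\<close>

definition below :: "(('a ordered_digraph \<times> 'a) \<times> ('a ordered_digraph \<times> 'a)) set" where
  "below = {((G, v), (H, u)). G = H \<and> ordered_dag G \<and> (u, v) \<in> adjacency G}"

lemma wf_below: "wf below"
proof (rule wfUNIVI, clarify)
  fix P :: "'a ordered_digraph \<times> 'a \<Rightarrow> bool" and G u
  assume step: "\<forall>x. (\<forall>y. (y, x) \<in> below \<longrightarrow> P y) \<longrightarrow> P x"
  show "P (G, u)"
  proof (cases "ordered_dag G")
    case True
    have "adjacency G \<subseteq> nodes G \<times> nodes G"
      using True by (auto simp: ordered_dag_def adjacency_def)
    then have "finite (adjacency G)"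
      using True by (meson finite_SigmaI finite_subset ordered_dag_def)
    then have "wf ((adjacency G)\<inverse>)"
      using True by (simp add: finite_acyclic_wf_converse ordered_dag_def)
    then show ?thesis
    proof (induction u rule: wf_induct_rule)
      case (less u)
      have "P y" if "(y, (G, u)) \<in> below" for y
        using that less.IH by (cases y) (simp add: below_def)
      then show ?case using step by blast
    qed
  next
    case False
    then have "(y, (G, u)) \<notin> below" for y
      by (cases y) (auto simp: below_def)
    then show ?thesis using step by blast
  qed
qed

text \<open>
  A tree whose leaves are \<open>Node []\<close>. Below a node of an ordered DAG, the leaves of the
  unfolding are the paths ending in a sink.
\<close>

datatype ordered_tree = Node "ordered_tree list"

function tree_of :: "'a ordered_digraph \<Rightarrow> 'a \<Rightarrow> ordered_tree" where
  "tree_of G u =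
     Node (if ordered_dag G \<and> u \<in> nodes G then map (\<lambda>c. tree_of G c) (children G u) else [])"
  by pat_completeness auto
termination
  by (relation below, rule wf_below) (auto simp: below_def adjacency_def)

declare tree_of.simps [simp del]

definition compacted_tree :: "nat \<Rightarrow> 'a ordered_digraph \<Rightarrow> bool" where
  "compacted_tree k G \<longleftrightarrow>
     relaxed_tree k G \<and>
     (\<forall>u \<in> internal_nodes G. \<forall>v \<in> internal_nodes G.
        u \<noteq> v \<longrightarrow> tree_of G u \<noteq> tree_of G v)"

record 'a dfs_state =
  visited :: "'a set"
  tree_edges :: "('a \<times> nat) set"

function dfs :: "'a ordered_digraph \<Rightarrow> 'a \<Rightarrow> 'a dfs_state \<Rightarrow> 'a dfs_state" where
  "dfs G u =
     (if ordered_dag G \<and> u \<in> nodes G then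
        (\<lambda>st. fold
          (\<lambda>i st'.
             if children G u ! i \<in> visited st' then st'
             else dfs G (children G u ! i) (st'\<lparr>tree_edges := insert (u, i) (tree_edges st')\<rparr>))
          [0..<length (children G u)]
          (st\<lparr>visited := insert u (visited st)\<rparr>))
      else (\<lambda>st. st))"
  by pat_completeness auto
termination
  by (relation below, rule wf_below) (auto simp: below_def adjacency_def)

declare dfs.simps [simp del]

definition source :: "'a ordered_digraph \<Rightarrow> 'a" where
  "source G = (THE s. is_source G s)"

definition spine :: "'a ordered_digraph \<Rightarrow> ('a \<times> nat) set" where
  "spine G = tree_edges (dfs G (source G) \<lparr>visited = {}, tree_edges = {}\<rparr>)"

text \<open>
  The spine spans the sink as well, so the edge by which the search first reaches the sink is
  not a pointer.
\<close>

definition pointers :: "'a ordered_digraph \<Rightarrow> ('a \<times> nat) set" where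
  "pointers G = edges G - spine G"

definition cherry :: "'a ordered_digraph \<Rightarrow> 'a \<Rightarrow> bool" where
  "cherry G u \<longleftrightarrow>
     u \<in> internal_nodes G \<and> (\<forall>i < length (children G u). (u, i) \<in> pointers G)"

function postorder_from :: "'a ordered_digraph \<Rightarrow> 'a \<Rightarrow> 'a list" where
  "postorder_from G u =
     (if ordered_dag G \<and> u \<in> nodes G then
        concat (map (\<lambda>i. postorder_from G (children G u ! i))
          (filter (\<lambda>i. (u, i) \<in> spine G) [0..<length (children G u)])) @ [u]
      else [])"
  by pat_completeness auto
termination
  by (relation below, rule wf_below) (auto simp: below_def adjacency_def)

declare postorder_from.simps [simp del]

definition postorder :: "'a ordered_digraph \<Rightarrow> 'a list" where
  "postorder G = postorder_from G (source G)"

definition precedes :: "'a ordered_digraph \<Rightarrow> 'a \<Rightarrow> 'a \<Rightarrow> bool" where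
  "precedes G u v \<longleftrightarrow>
     (\<exists>i j. i < j \<and> j < length (postorder G) \<and> postorder G ! i = u \<and> postorder G ! j = v)"

end

theory Submission
  imports Defs
begin

text \<open>
  If two internal nodes have the same unfolding, a pair whose unfolding is of least size has
  equal lists of children. Now let \<open>u\<close> and \<open>v\<close> be distinct nodes with the same children, \<open>u\<close>
  before \<open>v\<close> in postorder. Either \<open>v\<close> is a spine ancestor of \<open>u\<close>, so that some child of \<open>v\<close>,
  which is also a child of \<open>u\<close>, reaches \<open>u\<close>, contradicting acyclicity; or the search enters \<open>v\<close>
  after having left \<open>u\<close>, so that all children of \<open>v\<close> are already visited and \<open>v\<close> is a cherry.
\<close>

section \<open>Ordered DAGs\<close>

text \<open>\<open>below\<close> lives on pairs of a graph and a node; holding the graph at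
  \<open>G\<close> turns its well-foundedness into an induction over nodes that follows the
  recursion of \<open>tree_of\<close>, \<open>dfs\<close> and \<open>postorder_from\<close>.\<close>

lemma dag_children_induct [consumes 2, case_names step]:
  assumes "ordered_dag G" and "u \<in> nodes G"
    and "\<And>u. u \<in> nodes G \<Longrightarrow> (\<And>c. c \<in> set (children G u) \<Longrightarrow> P c) \<Longrightarrow> P u"
  shows "P u"
proof -
  have "snd x \<in> nodes G \<longrightarrow> P (snd x)" if "fst x = G" for x
    using wf_below that
  proof (induction x rule: wf_induct_rule)
    case (less x)
    show ?case
    proof
      assume x: "snd x \<in> nodes G"
      have "P c" if c: "c \<in> set (children G (snd x))" for c
      proof -
        have "((G, c), x) \<in> below"
          using c x less.prems assms(1) by (cases x) (auto simp: below_def adjacency_def)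
        moreover have "c \<in> nodes G"
          using c x assms(1) by (auto simp: ordered_dag_def)
        ultimately show ?thesis using less.IH by fastforce
      qed
      then show "P (snd x)" using assms(3) x by blast
    qed
  qed
  from this[of "(G, u)"] show ?thesis using assms(2) by simp
qed

lemma nth_child_in_nodes:
  assumes "ordered_dag G" and "u \<in> nodes G" and "i < length (children G u)"
  shows "children G u ! i \<in> nodes G"
  using assms nth_mem by (fastforce simp: ordered_dag_def)

lemma finite_adjacency:
  assumes "ordered_dag G"
  shows "finite (adjacency G)"
proof (rule finite_subset)
  show "adjacency G \<subseteq> nodes G \<times> nodes G"
    using assms by (auto simp: ordered_dag_def adjacency_def)
  show "finite (nodes G \<times> nodes G)"
    using assms by (simp add: ordered_dag_def)
qed

text \<open>Passing from a node to a parent must stop, since the edge relation is finite and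
  acyclic, and it can stop only at the unique source. Membership in \<open>A\<close> then travels
  back down the edges. Applied below to the set of visited nodes.\<close>

lemma nodes_subset_if_children_closed:
  assumes dag: "ordered_dag G" and src: "\<exists>!s. is_source G s"
    and "source G \<in> A"
    and closed: "\<And>u. u \<in> A \<Longrightarrow> u \<in> nodes G \<Longrightarrow> set (children G u) \<subseteq> A"
  shows "nodes G \<subseteq> A"
proof
  fix x
  have "wf (adjacency G)"
    using dag by (simp add: finite_acyclic_wf finite_adjacency ordered_dag_def)
  then show "x \<in> nodes G \<Longrightarrow> x \<in> A"
  proof (induction x rule: wf_induct_rule)
    case (less x)
    show ?case
    proof (cases "is_source G x")
      case True
      then have "source G = x"
        using src unfolding source_def by (simp add: the1_equality)
      then show ?thesis using assms(3) by simp
    next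
      case False
      then obtain u where u: "u \<in> nodes G" "x \<in> set (children G u)"
        using less.prems by (auto simp: is_source_def)
      then have "u \<in> A" using less.IH by (auto simp: adjacency_def)
      then show ?thesis using closed u by blast
    qed
  qed
qed

section \<open>Unfoldings\<close>

lemma tree_of_node:
  assumes "ordered_dag G" and "u \<in> nodes G"
  shows "tree_of G u = Node (map (tree_of G) (children G u))"
  using assms by (subst tree_of.simps) simp

text \<open>Descent: where the two lists of children differ, the children at that position are
  distinct nodes with the same unfolding. Admitting all nodes in the premises spares a proof that
  these children are internal.\<close>

lemma tree_of_eq_imp_same_children:
  assumes rel: "relaxed_tree k G"
    and "u \<in> nodes G" "v \<in> nodes G" "u \<noteq> v" "tree_of G u = tree_of G v"
  shows "\<exists>u\<in>internal_nodes G. \<exists>v\<in>internal_nodes G. u \<noteq> v \<and> children G u = children G v"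
    (is ?goal)
proof -
  have dag: "ordered_dag G" and sink: "\<exists>!t. is_sink G t"
    using rel by (auto simp: relaxed_tree_def)
  have "\<forall>v\<in>nodes G. u \<noteq> v \<longrightarrow> tree_of G u = tree_of G v \<longrightarrow> ?goal"
    using dag assms(2)
  proof (induction u rule: dag_children_induct)
    case (step u)
    show ?case
    proof (intro ballI impI)
      fix v assume v: "v \<in> nodes G" "u \<noteq> v" "tree_of G u = tree_of G v"
      have eq: "map (tree_of G) (children G u) = map (tree_of G) (children G v)"
        using v(3) tree_of_node[OF dag] step.hyps v(1) by simp
      show ?goal
      proof (cases "children G u = children G v")
        case True
        \<comment> \<open>If one were a sink, equal children would make both sinks, against
          uniqueness.\<close>
        have "\<not> is_sink G u" "\<not> is_sink G v"
          using True sink v step.hyps by (auto simp: is_sink_def)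
        then show ?thesis
          using True v step.hyps by (auto simp: internal_nodes_def)
      next
        case False
        have len: "length (children G u) = length (children G v)"
          using eq by (rule map_eq_imp_length_eq)
        then obtain i where i: "i < length (children G u)" "children G u ! i \<noteq> children G v ! i"
          using False by (auto simp: list_eq_iff_nth_eq)
        then have "tree_of G (children G u ! i) = tree_of G (children G v ! i)"
          using arg_cong[OF eq, of "\<lambda>xs. xs ! i"] len by simp
        moreover have "children G v ! i \<in> nodes G"
          using i(1) len v(1) dag by (simp add: nth_child_in_nodes)
        ultimately show ?thesis
          using step.IH[OF nth_mem[OF i(1)]] i(2) by blast
      qed
    qed
  qed
  then show ?thesis using assms by blast
qed

text \<open>An unfolding depends on its node only through the children, which gives one direction;
  the descent above gives the other.\<close>

lemma compacted_tree_iff: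
  assumes "relaxed_tree k G"
  shows "compacted_tree k G \<longleftrightarrow>
    \<not> (\<exists>u\<in>internal_nodes G. \<exists>v\<in>internal_nodes G. u \<noteq> v \<and> children G u = children G v)"
proof -
  have dag: "ordered_dag G" using assms by (simp add: relaxed_tree_def)
  have sub: "internal_nodes G \<subseteq> nodes G" by (auto simp: internal_nodes_def)
  have "tree_of G u = tree_of G v"
    if "u \<in> internal_nodes G" "v \<in> internal_nodes G" "children G u = children G v" for u v
    using that sub tree_of_node[OF dag] by (metis subsetD)
  then show ?thesis
    using assms tree_of_eq_imp_same_children[OF assms] sub
    unfolding compacted_tree_def by (meson subsetD)
qed

section \<open>Depth-first search\<close>

text \<open>Names the loop body of \<open>dfs\<close>, so that folds over part of the outgoing edges
  can be treated by induction.\<close>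

definition dfs_edge :: "'a ordered_digraph \<Rightarrow> 'a \<Rightarrow> nat \<Rightarrow> 'a dfs_state \<Rightarrow> 'a dfs_state" where
  "dfs_edge G u i st =
     (if children G u ! i \<in> visited st then st
      else dfs G (children G u ! i) (st\<lparr>tree_edges := insert (u, i) (tree_edges st)\<rparr>))"

lemma dfs_node:
  assumes "ordered_dag G" and "u \<in> nodes G"
  shows "dfs G u st =
    fold (dfs_edge G u) [0..<length (children G u)] (st\<lparr>visited := insert u (visited st)\<rparr>)"
  using assms by (subst dfs.simps) (simp add: dfs_edge_def[abs_def])

text \<open>
  \<open>X\<close> collects the edges leaving the nodes that are still being processed: only these may be
  added to the tree although their tails were visited before.
\<close>

definition dfs_extends ::
  "'a ordered_digraph \<Rightarrow> ('a \<times> nat) set \<Rightarrow> 'a dfs_state \<Rightarrow> 'a dfs_state \<Rightarrow> bool" where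
  "dfs_extends G X st st' \<longleftrightarrow>
     visited st \<subseteq> visited st' \<and>
     tree_edges st \<subseteq> tree_edges st' \<and>
     (\<forall>w i. (w, i) \<in> tree_edges st' - tree_edges st \<longrightarrow>
        w \<in> visited st' \<and> (w \<in> visited st \<longrightarrow> (w, i) \<in> X) \<and> children G w ! i \<notin> visited st) \<and>
     (\<forall>w \<in> visited st' - visited st. set (children G w) \<subseteq> visited st')"

lemma dfs_extends_refl: "dfs_extends G X st st"
  by (simp add: dfs_extends_def)

text \<open>An edge added in the second stage whose tail was visited at the start has a tail visited
  in \<open>st'\<close> as well, so it lies in \<open>Y\<close>; hence the union.\<close>

lemma dfs_extends_trans:
  assumes "dfs_extends G X st st'" and "dfs_extends G Y st' st''"
  shows "dfs_extends G (X \<union> Y) st st''"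
proof -
  have mono: "visited st \<subseteq> visited st'" "visited st' \<subseteq> visited st''"
    "tree_edges st \<subseteq> tree_edges st'" "tree_edges st' \<subseteq> tree_edges st''"
    using assms by (simp_all add: dfs_extends_def)
  have "w \<in> visited st'' \<and> (w \<in> visited st \<longrightarrow> (w, i) \<in> X \<union> Y) \<and> children G w ! i \<notin> visited st"
    if "(w, i) \<in> tree_edges st'' - tree_edges st" for w i
  proof (cases "(w, i) \<in> tree_edges st'")
    case True
    then show ?thesis using that assms(1) mono by (auto simp: dfs_extends_def)
  next
    case False
    then show ?thesis using that assms(2) mono by (auto simp: dfs_extends_def)
  qed
  moreover have "set (children G w) \<subseteq> visited st''" if "w \<in> visited st'' - visited st" for w
  proof (cases "w \<in> visited st'")
    case True
    then have "set (children G w) \<subseteq> visited st'"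
      using that assms(1) by (simp add: dfs_extends_def)
    then show ?thesis using mono(2) by blast
  next
    case False
    then show ?thesis using that assms(2) by (simp add: dfs_extends_def)
  qed
  ultimately show ?thesis
    using mono unfolding dfs_extends_def by (meson order_trans)
qed

text \<open>What is known about the recursive call enters as a premise, to be supplied by the
  induction over nodes in \<open>dfs_extends_dfs\<close>.\<close>

lemma dfs_extends_edge:
  assumes "u \<in> visited st"
    and dfs: "\<And>st. children G u ! i \<notin> visited st \<Longrightarrow>
      dfs_extends G {} st (dfs G (children G u ! i) st) \<and>
      children G u ! i \<in> visited (dfs G (children G u ! i) st)"
  shows "dfs_extends G {(u, i)} st (dfs_edge G u i st)"
    and "children G u ! i \<in> visited (dfs_edge G u i st)"
proof -
  let ?st = "st\<lparr>tree_edges := insert (u, i) (tree_edges st)\<rparr>"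
  have "dfs_extends G {(u, i)} st (dfs_edge G u i st) \<and>
    children G u ! i \<in> visited (dfs_edge G u i st)"
  proof (cases "children G u ! i \<in> visited st")
    case True
    then show ?thesis by (simp add: dfs_edge_def dfs_extends_refl)
  next
    case False
    \<comment> \<open>The tail \<open>u\<close> is already visited, so this edge needs the
      allowance; the recursive call after it needs none.\<close>
    have "dfs_extends G {(u, i)} st ?st"
      using False assms(1) by (auto simp: dfs_extends_def)
    then show ?thesis
      using dfs_extends_trans[of G "{(u, i)}" st ?st "{}"] dfs[of ?st] False
      by (simp add: dfs_edge_def)
  qed
  then show "dfs_extends G {(u, i)} st (dfs_edge G u i st)"
    and "children G u ! i \<in> visited (dfs_edge G u i st)" by auto
qed

lemma dfs_extends_fold:
  assumes "u \<in> visited st"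
    and dfs: "\<And>i st. i \<in> set is \<Longrightarrow> children G u ! i \<notin> visited st \<Longrightarrow>
      dfs_extends G {} st (dfs G (children G u ! i) st) \<and>
      children G u ! i \<in> visited (dfs G (children G u ! i) st)"
  shows "dfs_extends G ({u} \<times> set is) st (fold (dfs_edge G u) is st) \<and>
    (\<forall>i\<in>set is. children G u ! i \<in> visited (fold (dfs_edge G u) is st))"
  using assms
proof (induction "is" arbitrary: st)
  case Nil
  then show ?case by (simp add: dfs_extends_refl)
next
  case (Cons i "is")
  let ?st = "dfs_edge G u i st" and ?st' = "fold (dfs_edge G u) is (dfs_edge G u i st)"
  have step: "dfs_extends G {(u, i)} st ?st" "children G u ! i \<in> visited ?st"
    using dfs_extends_edge[of u st G i] Cons.prems by auto
  then have "u \<in> visited ?st"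
    using Cons.prems(1) by (auto simp: dfs_extends_def)
  then have rest: "dfs_extends G ({u} \<times> set is) ?st ?st'"
    "\<forall>i\<in>set is. children G u ! i \<in> visited ?st'"
    using Cons.IH[of ?st] Cons.prems(2) by auto
  have "{(u, i)} \<union> {u} \<times> set is = {u} \<times> set (i # is)" by auto
  then have "dfs_extends G ({u} \<times> set (i # is)) st ?st'"
    using dfs_extends_trans[OF step(1) rest(1)] by simp
  moreover have "children G u ! i \<in> visited ?st'"
    using step(2) rest(1) by (auto simp: dfs_extends_def)
  ultimately show ?case using rest(2) by simp
qed

text \<open>The loop starts with \<open>u\<close> marked and so must allow its outgoing edges.
  Measured from before the marking, \<open>u\<close> is itself new, and the allowance shrinks to the
  empty set.\<close>

lemma dfs_extends_dfs:
  assumes dag: "ordered_dag G" and "u \<in> nodes G" and "u \<notin> visited st"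
  shows "dfs_extends G {} st (dfs G u st) \<and> u \<in> visited (dfs G u st)"
  using assms
proof (induction u arbitrary: st rule: dag_children_induct)
  case (step u)
  let ?is = "[0..<length (children G u)]"
  let ?st = "st\<lparr>visited := insert u (visited st)\<rparr>"
  have "dfs_extends G ({u} \<times> set ?is) ?st (dfs G u st) \<and>
    (\<forall>i\<in>set ?is. children G u ! i \<in> visited (dfs G u st))"
    unfolding dfs_node[OF dag step.hyps]
    by (rule dfs_extends_fold) (use step.IH in auto)
  then have "dfs_extends G ({u} \<times> set ?is) ?st (dfs G u st)"
    and "set (children G u) \<subseteq> visited (dfs G u st)"
    by (auto simp: set_conv_nth)
  then show ?case
    using step.prems by (auto simp: dfs_extends_def)
qed

section \<open>Postorder\<close>

lemma postorder_from_node: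
  assumes "ordered_dag G" and "u \<in> nodes G"
  shows "postorder_from G u =
    concat (map (\<lambda>i. postorder_from G (children G u ! i))
      (filter (\<lambda>i. (u, i) \<in> spine G) [0..<length (children G u)])) @ [u]"
  using assms by (subst postorder_from.simps) simp

lemma postorder_from_reachable:
  assumes dag: "ordered_dag G" and "u \<in> nodes G" and "x \<in> set (postorder_from G u)"
  shows "(u, x) \<in> (adjacency G)\<^sup>*"
  using assms
proof (induction u rule: dag_children_induct)
  case (step u)
  show ?case
  proof (cases "x = u")
    case False
    then obtain i where i: "i < length (children G u)"
      "x \<in> set (postorder_from G (children G u ! i))"
      using step.prems by (auto simp: postorder_from_node[OF dag step.hyps])
    then have "(children G u ! i, x) \<in> (adjacency G)\<^sup>*" using step.IH by simp
    moreover have "(u, children G u ! i) \<in> adjacency G"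
      using i(1) step.hyps by (simp add: adjacency_def)
    ultimately show ?thesis by (rule converse_rtrancl_into_rtrancl[rotated])
  qed simp
qed

text \<open>
  For \<open>a\<close> before \<open>b\<close> in postorder: either \<open>b\<close> is an ancestor of \<open>a\<close>, or the children of \<open>a\<close> are
  all visited before the search enters \<open>b\<close>.
\<close>

definition above_or_apart :: "'a ordered_digraph \<Rightarrow> 'a \<Rightarrow> 'a \<Rightarrow> bool" where
  "above_or_apart G a b \<longleftrightarrow>
     (b, a) \<in> (adjacency G)\<^sup>+ \<or>
     (\<forall>i. (b, i) \<in> spine G \<longrightarrow> children G b ! i \<notin> set (children G a))"

text \<open>\<open>postorder_from\<close> consults the spine of the whole search, an intermediate
  state only the edges found so far. The comparison is confined to \<open>A\<close> because nodes
  still in progress may yet gain tree edges.\<close>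

definition spine_agrees :: "'a ordered_digraph \<Rightarrow> 'a set \<Rightarrow> 'a dfs_state \<Rightarrow> bool" where
  "spine_agrees G A st \<longleftrightarrow> (\<forall>w\<in>A. \<forall>i. (w, i) \<in> spine G \<longleftrightarrow> (w, i) \<in> tree_edges st)"

text \<open>\<open>xs\<close> is meant to be the stretch of the postorder produced between the two
  states.\<close>

definition dfs_lists :: "'a ordered_digraph \<Rightarrow> 'a dfs_state \<Rightarrow> 'a dfs_state \<Rightarrow> 'a list \<Rightarrow> bool" where
  "dfs_lists G st st' xs \<longleftrightarrow>
     set xs = visited st' - visited st \<and> sorted_wrt (above_or_apart G) xs"

text \<open>Induction over the remaining positions, with the final state \<open>st'\<close> of the
  loop held fixed. As \<open>u\<close> is in progress, it lies outside the set on which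
  \<open>agree\<close> compares, so \<open>new\<close> and \<open>agree_u\<close> treat its edges
  separately. By \<open>tails\<close>, a node not yet visited has no outgoing tree edge.\<close>

lemma dfs_lists_fold:
  assumes dag: "ordered_dag G" and u: "u \<in> nodes G" "u \<in> visited st"
    and tails: "fst ` tree_edges st \<subseteq> visited st"
    and "distinct is" and len: "\<forall>i\<in>set is. i < length (children G u)"
    and new: "\<forall>i\<in>set is. (u, i) \<notin> tree_edges st"
    and agree_u: "\<forall>i\<in>set is. (u, i) \<in> spine G \<longleftrightarrow> (u, i) \<in> tree_edges st'"
    and st': "st' = fold (dfs_edge G u) is st"
    and agree: "spine_agrees G (visited st' - visited st) st'"
    and lists: "\<And>i st. i < length (children G u) \<Longrightarrow> children G u ! i \<notin> visited st \<Longrightarrow>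
      fst ` tree_edges st \<subseteq> visited st \<Longrightarrow>
      spine_agrees G (visited (dfs G (children G u ! i) st) - visited st)
        (dfs G (children G u ! i) st) \<Longrightarrow>
      dfs_lists G st (dfs G (children G u ! i) st) (postorder_from G (children G u ! i))"
  shows "dfs_lists G st st' (concat (map (\<lambda>i. postorder_from G (children G u ! i))
    (filter (\<lambda>i. (u, i) \<in> spine G) is)))"
  using u(2) tails assms(5) len new agree_u st' agree
proof (induction "is" arbitrary: st)
  case Nil
  then show ?case by (simp add: dfs_lists_def)
next
  case (Cons i "is")
  let ?c = "children G u ! i"
  let ?st0 = "st\<lparr>tree_edges := insert (u, i) (tree_edges st)\<rparr>"
  define st1 where "st1 = dfs_edge G u i st"
  let ?xs = "if (u, i) \<in> spine G then postorder_from G ?c else []"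
  let ?ys = "concat (map (\<lambda>i. postorder_from G (children G u ! i))
    (filter (\<lambda>i. (u, i) \<in> spine G) is))"
  have ext_dfs: "dfs_extends G {} st (dfs G (children G u ! j) st) \<and>
      children G u ! j \<in> visited (dfs G (children G u ! j) st)"
    if "j < length (children G u)" "children G u ! j \<notin> visited st" for j st
    using that dag u(1) by (intro dfs_extends_dfs nth_child_in_nodes)
  have i: "i < length (children G u)" using Cons.prems by simp
  have ext1: "dfs_extends G {(u, i)} st st1"
    unfolding st1_def using Cons.prems(1) ext_dfs i by (intro dfs_extends_edge) auto
  have mono1: "visited st \<subseteq> visited st1" using ext1 by (simp add: dfs_extends_def)
  then have u1: "u \<in> visited st1" using Cons.prems(1) by blast
  have tails1: "fst ` tree_edges st1 \<subseteq> visited st1"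
  proof clarify
    fix w j assume e: "(w, j) \<in> tree_edges st1"
    show "fst (w, j) \<in> visited st1"
    proof (cases "(w, j) \<in> tree_edges st")
      case True
      then have "w \<in> visited st" using Cons.prems(2) by force
      then show ?thesis using mono1 by auto
    next
      case False
      then show ?thesis using e ext1 by (simp add: dfs_extends_def)
    qed
  qed
  have st'1: "st' = fold (dfs_edge G u) is st1" using Cons.prems by (simp add: st1_def)
  have ext2: "dfs_extends G ({u} \<times> set is) st1 st'"
    unfolding st'1 using dfs_extends_fold[of u st1 "is" G] u1 ext_dfs Cons.prems(4) by simp
  have mono2: "visited st1 \<subseteq> visited st'" using ext2 by (simp add: dfs_extends_def)
  \<comment> \<open>The rest of the loop may add edges leaving \<open>u\<close> only at positions in
    \<open>is\<close>, and \<open>i\<close> is not among them by distinctness.\<close>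
  have edge: "(u, i) \<in> spine G \<longleftrightarrow> (u, i) \<in> tree_edges st1"
    using Cons.prems(3,6) ext2 u1 by (auto simp: dfs_extends_def)
  \<comment> \<open>Nodes new in \<open>st1\<close> differ from \<open>u\<close> and are finished,
    so the rest of the loop adds no edge leaving them.\<close>
  have agree1: "spine_agrees G (visited st1 - visited st) st1"
    unfolding spine_agrees_def
  proof (intro ballI allI)
    fix w j assume w: "w \<in> visited st1 - visited st"
    have "(w, j) \<in> spine G \<longleftrightarrow> (w, j) \<in> tree_edges st'"
      using w Cons.prems(8) ext2 by (auto simp: spine_agrees_def dfs_extends_def)
    also have "\<dots> \<longleftrightarrow> (w, j) \<in> tree_edges st1"
      using w Cons.prems(1) ext2 by (auto simp: dfs_extends_def)
    finally show "(w, j) \<in> spine G \<longleftrightarrow> (w, j) \<in> tree_edges st1" .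
  qed
  \<comment> \<open>The edge belongs to the spine exactly if its head is unvisited in
    \<open>st\<close>; otherwise nothing is visited and nothing is listed.\<close>
  have xs: "dfs_lists G st st1 ?xs"
  proof (cases "?c \<in> visited st")
    case True
    then have "st1 = st" by (simp add: st1_def dfs_edge_def)
    then show ?thesis using edge Cons.prems(5) by (simp add: dfs_lists_def)
  next
    case False
    then have st1: "st1 = dfs G ?c ?st0" by (simp add: st1_def dfs_edge_def)
    have "(u, i) \<in> tree_edges st1"
      using ext_dfs[of i ?st0] i False by (auto simp: st1 dfs_extends_def)
    moreover have "dfs_lists G ?st0 st1 (postorder_from G ?c)"
      unfolding st1 using Cons.prems(1,2) i False agree1
      by (intro lists) (auto simp: st1)
    ultimately show ?thesis using edge by (simp add: dfs_lists_def)
  qed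
  have ys: "dfs_lists G st1 st' ?ys"
  proof (rule Cons.IH)
    show "\<forall>j\<in>set is. (u, j) \<notin> tree_edges st1"
    proof
      fix j assume "j \<in> set is"
      then have "(u, j) \<notin> tree_edges st" "(u, j) \<notin> {(u, i)}"
        using Cons.prems(3,5) by auto
      then show "(u, j) \<notin> tree_edges st1"
        using Cons.prems(1) ext1 unfolding dfs_extends_def by (meson DiffI)
    qed
    show "spine_agrees G (visited st' - visited st1) st'"
      using Cons.prems(8) mono1 by (auto simp: spine_agrees_def)
  qed (use u1 tails1 st'1 Cons.prems in auto)
  \<comment> \<open>Across the two stretches: \<open>a\<close> is finished in \<open>st1\<close>, so
    its children are visited there, whereas the spine edges leaving \<open>b\<close> are added later
    and lead to nodes unvisited in \<open>st1\<close>.\<close>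
  have "above_or_apart G a b" if "a \<in> set ?xs" "b \<in> set ?ys" for a b
  proof -
    have a: "a \<in> visited st1 - visited st" and b: "b \<in> visited st' - visited st1"
      using that xs ys unfolding dfs_lists_def by auto
    have "children G b ! j \<notin> set (children G a)" if "(b, j) \<in> spine G" for j
    proof -
      have "(b, j) \<in> tree_edges st'"
        using that b Cons.prems(8) mono1 by (auto simp: spine_agrees_def)
      moreover have "(b, j) \<notin> tree_edges st1" using b tails1 by force
      ultimately have "children G b ! j \<notin> visited st1"
        using ext2 by (simp add: dfs_extends_def)
      moreover have "set (children G a) \<subseteq> visited st1"
        using a ext1 by (simp add: dfs_extends_def)
      ultimately show ?thesis by blast
    qed
    then show ?thesis by (simp add: above_or_apart_def)
  qed
  moreover have "visited st' - visited st = (visited st1 - visited st) \<union> (visited st' - visited st1)"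
    using mono1 mono2 by blast
  ultimately have "dfs_lists G st st' (?xs @ ?ys)"
    using xs ys unfolding dfs_lists_def sorted_wrt_append set_append by blast
  then show ?case by (simp split: if_splits)
qed

text \<open>The loop over the children lists what is newly visited after marking \<open>u\<close>.
  Appending \<open>u\<close> keeps the order, since \<open>u\<close> reaches every listed node and
  is not listed itself, so it is a proper ancestor of each.\<close>

lemma dfs_lists_dfs:
  assumes dag: "ordered_dag G" and "u \<in> nodes G" and "u \<notin> visited st"
    and "fst ` tree_edges st \<subseteq> visited st"
    and "spine_agrees G (visited (dfs G u st) - visited st) (dfs G u st)"
  shows "dfs_lists G st (dfs G u st) (postorder_from G u)"
  using assms
proof (induction u arbitrary: st rule: dag_children_induct)
  case (step u)
  let ?st = "st\<lparr>visited := insert u (visited st)\<rparr>"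
  let ?xs = "concat (map (\<lambda>i. postorder_from G (children G u ! i))
      (filter (\<lambda>i. (u, i) \<in> spine G) [0..<length (children G u)]))"
  have u': "u \<in> visited (dfs G u st)" and ext: "visited st \<subseteq> visited (dfs G u st)"
    using dfs_extends_dfs[OF dag step.hyps step.prems(1)] by (auto simp: dfs_extends_def)
  have xs: "dfs_lists G ?st (dfs G u st) ?xs"
  proof (rule dfs_lists_fold[OF dag step.hyps])
    show "fst ` tree_edges ?st \<subseteq> visited ?st" using step.prems by auto
    \<comment> \<open>All tails of tree edges in \<open>st\<close> are visited there, and
      \<open>u\<close> is not.\<close>
    show "\<forall>i\<in>set [0..<length (children G u)]. (u, i) \<notin> tree_edges ?st"
      using step.prems by force
    show "\<forall>i\<in>set [0..<length (children G u)].
        (u, i) \<in> spine G \<longleftrightarrow> (u, i) \<in> tree_edges (dfs G u st)"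
      using step.prems u' by (simp add: spine_agrees_def)
    show "spine_agrees G (visited (dfs G u st) - visited ?st) (dfs G u st)"
      using step.prems by (simp add: spine_agrees_def)
  qed (use dfs_node[OF dag step.hyps] step.IH in auto)
  have "above_or_apart G a u" if "a \<in> set ?xs" for a
  proof -
    have "a \<noteq> u" using that xs unfolding dfs_lists_def by auto
    moreover have "(u, a) \<in> (adjacency G)\<^sup>*"
      using that by (intro postorder_from_reachable[OF dag step.hyps])
        (simp add: postorder_from_node[OF dag step.hyps])
    ultimately show ?thesis by (simp add: above_or_apart_def rtrancl_eq_or_trancl)
  qed
  then have "sorted_wrt (above_or_apart G) (?xs @ [u])"
    using xs unfolding dfs_lists_def sorted_wrt_append
    by (simp only: sorted_wrt.simps list.set) blast
  moreover have "set (?xs @ [u]) = visited (dfs G u st) - visited st"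
    using xs u' step.prems(1) unfolding dfs_lists_def by auto
  ultimately show ?case
    unfolding postorder_from_node[OF dag step.hyps] dfs_lists_def by blast
qed

text \<open>For the search from the empty state, the final tree edges are the spine by definition,
  so agreement is immediate. The visited set contains the source and is closed under children, hence
  covers all nodes.\<close>

lemma postorder_props:
  assumes dag: "ordered_dag G" and src: "\<exists>!s. is_source G s"
  shows "nodes G \<subseteq> set (postorder G)" and "sorted_wrt (above_or_apart G) (postorder G)"
proof -
  let ?st = "\<lparr>visited = {}, tree_edges = {}\<rparr> :: 'a dfs_state"
  let ?st' = "dfs G (source G) ?st"
  have s: "source G \<in> nodes G"
    using theI'[OF src] by (simp add: source_def is_source_def)
  have ext: "dfs_extends G {} ?st ?st'" "source G \<in> visited ?st'"
    using dfs_extends_dfs[OF dag s, of ?st] by auto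
  have "dfs_lists G ?st ?st' (postorder G)"
    unfolding postorder_def
    by (intro dfs_lists_dfs[OF dag s]) (auto simp: spine_agrees_def spine_def)
  then have "set (postorder G) = visited ?st'"
    and sorted: "sorted_wrt (above_or_apart G) (postorder G)"
    by (auto simp: dfs_lists_def)
  moreover have "nodes G \<subseteq> visited ?st'"
    using ext by (intro nodes_subset_if_children_closed[OF dag src]) (auto simp: dfs_extends_def)
  ultimately show "nodes G \<subseteq> set (postorder G)" by simp
  show "sorted_wrt (above_or_apart G) (postorder G)" by (rule sorted)
qed

section \<open>Pairs of nodes with equal children\<close>

lemma cherry_if_same_children:
  assumes dag: "ordered_dag G" and src: "\<exists>!s. is_source G s"
    and u: "u \<in> internal_nodes G" and v: "v \<in> internal_nodes G"
    and eq: "children G u = children G v" and "precedes G u v"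
  shows "cherry G v"
proof -
  have "above_or_apart G u v"
    using \<open>precedes G u v\<close> postorder_props(2)[OF dag src]
    by (auto simp: precedes_def sorted_wrt_iff_nth_less)
  moreover have "(v, u) \<notin> (adjacency G)\<^sup>+"
  proof
    assume "(v, u) \<in> (adjacency G)\<^sup>+"
    then obtain c where c: "(v, c) \<in> adjacency G" "(c, u) \<in> (adjacency G)\<^sup>*"
      by (meson tranclD)
    \<comment> \<open>The child \<open>c\<close> of \<open>v\<close> that leads to \<open>u\<close>
      is a child of \<open>u\<close> too, which closes a cycle.\<close>
    then have "(u, c) \<in> adjacency G"
      using u eq by (simp add: adjacency_def internal_nodes_def)
    then have "(u, u) \<in> (adjacency G)\<^sup>+" using c(2) by (rule rtrancl_into_trancl2)
    then show False using dag by (simp add: ordered_dag_def acyclic_def)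
  qed
  \<comment> \<open>What remains is the second alternative: spine edges of \<open>v\<close> avoid
    the children of \<open>u\<close>, and these are all the children of \<open>v\<close>.\<close>
  ultimately have "(v, i) \<notin> spine G" if "i < length (children G v)" for i
    using that eq by (auto simp: above_or_apart_def)
  then show ?thesis
    using v by (auto simp: cherry_def pointers_def edges_def internal_nodes_def)
qed

theorem theorem2:
  fixes k :: nat and C :: "'a ordered_digraph"
  assumes "k \<ge> 2" and "relaxed_tree k C"
  shows "(compacted_tree k C \<longleftrightarrow>
            \<not> (\<exists>u \<in> internal_nodes C. \<exists>v \<in> internal_nodes C.
                 u \<noteq> v \<and> children C u = children C v)) \<and>
         (\<not> compacted_tree k C \<longrightarrow>
            (\<exists>u \<in> internal_nodes C. \<exists>v \<in> internal_nodes C.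
               u \<noteq> v \<and> children C u = children C v \<and> cherry C v \<and> precedes C u v))"
proof (intro conjI impI)
  note iff = compacted_tree_iff[OF assms(2)]
  then show "compacted_tree k C \<longleftrightarrow> \<not> (\<exists>u \<in> internal_nodes C. \<exists>v \<in> internal_nodes C.
                 u \<noteq> v \<and> children C u = children C v)" .
  have dag: "ordered_dag C" and src: "\<exists>!s. is_source C s"
    using assms(2) by (auto simp: relaxed_tree_def)
  assume "\<not> compacted_tree k C"
  then obtain u v where uv: "u \<in> internal_nodes C" "v \<in> internal_nodes C" "u \<noteq> v"
    "children C u = children C v"
    using iff by blast
  then have "u \<in> set (postorder C)" "v \<in> set (postorder C)"
    using postorder_props(1)[OF dag src] by (auto simp: internal_nodes_def)
  \<comment> \<open>Distinct nodes occupy distinct positions; equality of children is symmetric, so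
    the two nodes may be swapped.\<close>
  then have "precedes C u v \<or> precedes C v u"
    using uv(3) by (metis in_set_conv_nth linorder_neqE_nat precedes_def)
  then show "\<exists>u \<in> internal_nodes C. \<exists>v \<in> internal_nodes C.
               u \<noteq> v \<and> children C u = children C v \<and> cherry C v \<and> precedes C u v"
    using uv cherry_if_same_children[OF dag src] by metis
qed

end
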